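(* Let $G$ be a finite group with $\pi(G)=\{p,q,r\}$, where $p,q,r$ are pairwise distinct primes. Then the coprime graph $\Gamma(G)$ is a divisor graph if and only if $\{pq,pr,qr\}\nsubseteq\pi_e(G)$.
   Context: $\pi(G)$ is the set of prime divisors of $|G|$, and $\pi_e(G)$ is the set of orders of the non-identity elements of $G$. The coprime graph $\Gamma(G)$ is the simple undirected graph with vertex set $G$ in which two distinct vertices $x,y$ are adjacent if and only if $\gcd(o(x),o(y))=1$, where $o(x)$ is the order of $x$. A simple undirected graph $\Gamma$ is a divisor graph if there is an injection $\alpha$ from $V(\Gamma)$ to the set of positive integers such that distinct $x,y\in V(\Gamma)$ are adjacent if and only if $\alpha(x)\mid\alpha(y)$ or $\alpha(y)\mid\alpha(x)$. *)

theory Defs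
  imports "HOL-Algebra.Multiplicative_Group" "HOL-Computational_Algebra.Primes"
    "Graph_Theory.Pair_Digraph"
begin

definition prime_divisors :: "('a, 'b) monoid_scheme \<Rightarrow> nat set" where
  "prime_divisors G = {p. prime p \<and> p dvd order G}"

definition element_orders :: "('a, 'b) monoid_scheme \<Rightarrow> nat set" where
  "element_orders G = {group.ord G x | x. x \<in> carrier G \<and> x \<noteq> \<one>\<^bsub>G\<^esub>}"

text \<open>A simple undirected graph is a symmetric loop-free relation on the vertex set, that is, a
  \<^const>\<open>pair_bidirected_digraph\<close>; an edge between \<open>x\<close> and \<open>y\<close> is the pair of arcs
  \<open>(x, y)\<close>, \<open>(y, x)\<close>.\<close>

definition coprime_graph :: "('a, 'b) monoid_scheme \<Rightarrow> 'a pair_pre_digraph" where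
  "coprime_graph G =
     \<lparr> pverts = carrier G,
       parcs = {(x, y). x \<in> carrier G \<and> y \<in> carrier G \<and> x \<noteq> y \<and>
                        gcd (group.ord G x) (group.ord G y) = 1} \<rparr>"

lemma coprime_graph_simple: "pair_bidirected_digraph (coprime_graph G)"
  by unfold_locales
    (auto simp: coprime_graph_def symmetric_def sym_def gcd.commute)

definition divisor_graph :: "'a pair_pre_digraph \<Rightarrow> bool" where
  "divisor_graph \<Gamma> \<longleftrightarrow>
     pair_bidirected_digraph \<Gamma> \<and>
     (\<exists>\<alpha> :: 'a \<Rightarrow> nat.
        \<alpha> ` pverts \<Gamma> \<subseteq> {0<..} \<and> inj_on \<alpha> (pverts \<Gamma>) \<and>
        (\<forall>x\<in>pverts \<Gamma>. \<forall>y\<in>pverts \<Gamma>. x \<noteq> y \<longrightarrow>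
           ((x, y) \<in> parcs \<Gamma> \<longleftrightarrow> \<alpha> x dvd \<alpha> y \<or> \<alpha> y dvd \<alpha> x)))"

end

theory Submission
  imports Defs
begin

text \<open>
  A finite graph is a divisor graph exactly when its edges are the comparable pairs of some partial
  order. The identity is adjacent to everything, and whether two other elements are adjacent depends
  only on the sets of primes dividing their orders, so the question is how these sets can meet.

  If \<open>pq\<close>, \<open>pr\<close> and \<open>qr\<close> are all element orders, then elements of orders \<open>p\<close>, \<open>q\<close>, \<open>r\<close> form a
  triangle, and elements of orders \<open>qr\<close>, \<open>pr\<close>, \<open>pq\<close> are pendant at its three corners. In a partial
  order the triangle would be a chain, and whatever is comparable with the middle corner is also
  comparable with the top or with the bottom corner; so no pendant vertex can hang at the middle
  corner (\<open>no_net_in_divisor_graph\<close>).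

  If, say, \<open>qr\<close> is not an element order, then no element order is divisible by both \<open>q\<close> and \<open>r\<close>.
  Put the identity at the bottom, above it the elements whose order is divisible by \<open>q\<close>, then the
  nontrivial \<open>p\<close>-elements, then the elements whose order is divisible by \<open>r\<close>. Two distinct elements
  of one layer are never adjacent, and directing all edges upwards gives a transitive relation
  (\<open>coprime_layer_trans\<close>): a path through three nontrivial layers runs from a \<open>q\<close>-element
  through a \<open>p\<close>-element to an \<open>r\<close>-element.
\<close>

section \<open>Divisor graphs and partial orders\<close>

text \<open>Attach a distinct prime to every element and send an element to the product of the primes at
  or below it; divisibility then compares down-sets, hence elements.\<close>

lemma finite_order_embeds_in_divisibility:
  fixes V :: "'a set" and le :: "'a \<Rightarrow> 'a \<Rightarrow> bool"
  assumes "finite V"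
    and refl: "\<And>x. x \<in> V \<Longrightarrow> le x x"
    and trans: "\<And>x y z. \<lbrakk>x \<in> V; y \<in> V; z \<in> V; le x y; le y z\<rbrakk> \<Longrightarrow> le x z"
  obtains \<alpha> :: "'a \<Rightarrow> nat"
  where "\<And>x. \<alpha> x > 0" and "\<And>x y. \<lbrakk>x \<in> V; y \<in> V\<rbrakk> \<Longrightarrow> \<alpha> x dvd \<alpha> y \<longleftrightarrow> le x y"
proof -
  have "\<exists>P \<subseteq> {p::nat. prime p}. finite P \<and> card P = card V"
    using infinite_arbitrarily_large[OF primes_infinite] by blast
  then obtain P :: "nat set" where P: "P \<subseteq> {p. prime p}" "finite P" "card P = card V"
    by blast
  then obtain g where g: "bij_betw g V P"
    using finite_same_card_bij[OF \<open>finite V\<close>] by metis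
  have prime_g: "prime (g z)" if "z \<in> V" for z
    using that g P(1) by (auto simp: bij_betw_def)
  define \<alpha> where "\<alpha> y = (\<Prod>z\<in>{z\<in>V. le z y}. g z)" for y
  have g_dvd: "g x dvd \<alpha> y \<longleftrightarrow> le x y" if x: "x \<in> V" for x y
  proof
    assume "g x dvd \<alpha> y"
    then obtain z where z: "z \<in> V" "le z y" "g x dvd g z"
      using \<open>finite V\<close> prime_g[OF x] by (auto simp: \<alpha>_def prime_dvd_prod_iff)
    then have "g x = g z"
      using prime_g x primes_dvd_imp_eq by blast
    then have "x = z"
      using g x z(1) by (auto simp: bij_betw_def inj_on_def)
    then show "le x y"
      using z(2) by simp
  next
    assume "le x y"
    then show "g x dvd \<alpha> y"
      using \<open>finite V\<close> x by (auto simp: \<alpha>_def intro!: dvd_prodI)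
  qed
  show ?thesis
  proof
    show "\<alpha> x > 0" for x
      unfolding \<alpha>_def by (rule prod_pos) (use prime_g prime_gt_0_nat in blast)
    show "\<alpha> x dvd \<alpha> y \<longleftrightarrow> le x y" if "x \<in> V" "y \<in> V" for x y
    proof
      assume "\<alpha> x dvd \<alpha> y"
      moreover have "g x dvd \<alpha> x"
        using that refl by (simp add: g_dvd)
      ultimately show "le x y"
        using that by (metis g_dvd dvd_trans)
    next
      assume "le x y"
      then have "{z\<in>V. le z x} \<subseteq> {z\<in>V. le z y}"
        using trans that by blast
      then show "\<alpha> x dvd \<alpha> y"
        using \<open>finite V\<close> unfolding \<alpha>_def by (intro prod_dvd_prod_subset) auto
    qed
  qed
qed

lemma divisor_graph_if_transitively_oriented:
  fixes \<Gamma> :: "'a pair_pre_digraph" and less :: "'a \<Rightarrow> 'a \<Rightarrow> bool"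
  assumes "pair_bidirected_digraph \<Gamma>" and "finite (pverts \<Gamma>)"
    and irrefl: "\<And>x. x \<in> pverts \<Gamma> \<Longrightarrow> \<not> less x x"
    and trans: "\<And>x y z. \<lbrakk>x \<in> pverts \<Gamma>; y \<in> pverts \<Gamma>; z \<in> pverts \<Gamma>; less x y; less y z\<rbrakk> \<Longrightarrow> less x z"
    and edges: "\<And>x y. \<lbrakk>x \<in> pverts \<Gamma>; y \<in> pverts \<Gamma>; x \<noteq> y\<rbrakk> \<Longrightarrow>
      (x, y) \<in> parcs \<Gamma> \<longleftrightarrow> less x y \<or> less y x"
  shows "divisor_graph \<Gamma>"
proof -
  obtain \<alpha> :: "'a \<Rightarrow> nat" where pos: "\<And>x. \<alpha> x > 0"
    and \<alpha>: "\<And>x y. \<lbrakk>x \<in> pverts \<Gamma>; y \<in> pverts \<Gamma>\<rbrakk> \<Longrightarrow> \<alpha> x dvd \<alpha> y \<longleftrightarrow> x = y \<or> less x y"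
    using finite_order_embeds_in_divisibility[of "pverts \<Gamma>" "\<lambda>x y. x = y \<or> less x y"]
      assms(2) trans by (metis (no_types, lifting))
  have "inj_on \<alpha> (pverts \<Gamma>)"
  proof (rule inj_onI)
    fix x y assume xy: "x \<in> pverts \<Gamma>" "y \<in> pverts \<Gamma>" "\<alpha> x = \<alpha> y"
    then have "x = y \<or> less x y" "y = x \<or> less y x"
      using \<alpha>[of x y] \<alpha>[of y x] by simp_all
    then show "x = y"
      using xy trans[of x y x] irrefl by blast
  qed
  then show ?thesis
    unfolding divisor_graph_def using assms(1) pos \<alpha> edges by (intro conjI exI[of _ \<alpha>]) auto
qed

text \<open>The graph described by the hypotheses, a triangle with a pendant vertex at each corner, is
  called the net. The values of the labelling at the corners form a divisibility chain. If the
  label of a pendant vertex at the middle corner divides the middle label, it divides the top one;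
  otherwise it is a multiple of the bottom one.\<close>

lemma no_net_in_divisor_graph:
  assumes "divisor_graph \<Gamma>"
    and ab: "(a, b) \<in> parcs \<Gamma>" and ac: "(a, c) \<in> parcs \<Gamma>" and bc: "(b, c) \<in> parcs \<Gamma>"
    and a': "(a, a') \<in> parcs \<Gamma>" "(b, a') \<notin> parcs \<Gamma>" "(c, a') \<notin> parcs \<Gamma>"
    and b': "(b, b') \<in> parcs \<Gamma>" "(a, b') \<notin> parcs \<Gamma>" "(c, b') \<notin> parcs \<Gamma>"
    and c': "(c, c') \<in> parcs \<Gamma>" "(a, c') \<notin> parcs \<Gamma>" "(b, c') \<notin> parcs \<Gamma>"
  shows False
proof -
  from assms(1) interpret pair_bidirected_digraph \<Gamma>
    by (simp add: divisor_graph_def)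
  have sym: "(y, x) \<in> parcs \<Gamma>" if "(x, y) \<in> parcs \<Gamma>" for x y
    using that arcs_symmetric by blast
  obtain \<alpha> :: "'a \<Rightarrow> nat" where \<alpha>: "\<And>x y. \<lbrakk>x \<in> pverts \<Gamma>; y \<in> pverts \<Gamma>; x \<noteq> y\<rbrakk> \<Longrightarrow>
      (x, y) \<in> parcs \<Gamma> \<longleftrightarrow> \<alpha> x dvd \<alpha> y \<or> \<alpha> y dvd \<alpha> x"
    using assms(1) unfolding divisor_graph_def by blast
  have edge: "\<alpha> x dvd \<alpha> y \<or> \<alpha> y dvd \<alpha> x" if "(x, y) \<in> parcs \<Gamma>" for x y
    using that \<alpha> by (metis dvd_refl in_arcsD1 in_arcsD2)
  have not_middle: "\<not> (\<alpha> u dvd \<alpha> m \<and> \<alpha> m dvd \<alpha> v)"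
    if "(u, v) \<in> parcs \<Gamma>" and x: "(m, x) \<in> parcs \<Gamma>" "(u, x) \<notin> parcs \<Gamma>" "(v, x) \<notin> parcs \<Gamma>"
    for u m v x
  proof
    assume le: "\<alpha> u dvd \<alpha> m \<and> \<alpha> m dvd \<alpha> v"
    \<comment> \<open>A pendant vertex is distinct from the other two corners, which are adjacent to each other.\<close>
    have "x \<noteq> u" "x \<noteq> v"
      using that sym by blast+
    moreover have "u \<in> pverts \<Gamma>" "v \<in> pverts \<Gamma>" "x \<in> pverts \<Gamma>"
      using that in_arcsD1 in_arcsD2 by blast+
    moreover have "\<alpha> x dvd \<alpha> v \<or> \<alpha> u dvd \<alpha> x"
      using edge[OF x(1)] le dvd_trans by blast
    ultimately show False
      using \<alpha>[of u x] \<alpha>[of v x] x(2,3) by auto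
  qed
  show False
    using edge[OF ab] edge[OF ac] edge[OF bc]
      not_middle[OF bc a'] not_middle[OF sym[OF bc] a'(1) a'(3) a'(2)]
      not_middle[OF ac b'] not_middle[OF sym[OF ac] b'(1) b'(3) b'(2)]
      not_middle[OF ab c'] not_middle[OF sym[OF ab] c'(1) c'(3) c'(2)]
    by argo
qed

section \<open>Orders of elements\<close>

context group
begin

lemma exists_elem_ord_dvd:
  assumes "finite (carrier G)" and "x \<in> carrier G" and "d dvd ord x"
  obtains y where "y \<in> carrier G" and "ord y = d"
proof -
  from assms(3) obtain k where "ord x = d * k" ..
  moreover have "ord x \<ge> 1"
    using assms(1,2) by (rule ord_ge_1)
  ultimately have "ord (x [^] k) = d"
    using ord_pow[OF assms(2), of k] by auto
  then show ?thesis
    using that[of "x [^] k"] assms(2) by simp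
qed

lemma ord_in_element_orders:
  assumes "x \<in> carrier G" and "ord x \<noteq> 1"
  shows "ord x \<in> element_orders G"
proof -
  have "x \<noteq> \<one>"
    using assms(2) ord_id by metis
  then show ?thesis
    using assms(1) unfolding element_orders_def by blast
qed

end

lemma coprime_graph_arc_iff:
  "(x, y) \<in> parcs (coprime_graph G) \<longleftrightarrow>
    x \<in> carrier G \<and> y \<in> carrier G \<and> x \<noteq> y \<and> coprime (group.ord G x) (group.ord G y)"
  by (auto simp: coprime_graph_def coprime_iff_gcd_eq_1)

section \<open>A missing product of two primes\<close>

text \<open>The layer of an element of order \<open>n\<close>, numbered from the bottom. Elements of orders \<open>p\<close>, \<open>q\<close>,
  \<open>r\<close> form a triangle, and the middle one must have no pendant neighbour. Those of orders \<open>q\<close> and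
  \<open>r\<close> may have one, of order \<open>pr\<close> or \<open>pq\<close>, so the \<open>p\<close>-elements have to lie in the middle.\<close>

definition layer :: "nat \<Rightarrow> nat \<Rightarrow> nat \<Rightarrow> nat" where
  "layer q r n = (if n = 1 then 0 else if q dvd n then 1 else if r dvd n then 3 else 2)"

text \<open>Layers 1 and 3 have the common prime divisors \<open>q\<close> and \<open>r\<close>. In layer 2 no prime but \<open>p\<close> is left,
  so \<open>p\<close> is a common divisor.\<close>

lemma coprime_layer_neq:
  assumes "prime q" "prime r"
    and supp: "\<And>l. prime l \<Longrightarrow> l dvd m \<Longrightarrow> l \<in> {p, q, r}"
      "\<And>l. prime l \<Longrightarrow> l dvd n \<Longrightarrow> l \<in> {p, q, r}"
    and "coprime m n" and "\<not> (m = 1 \<and> n = 1)"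
  shows "layer q r m \<noteq> layer q r n"
proof
  assume eq: "layer q r m = layer q r n"
  then have ne: "m \<noteq> 1" "n \<noteq> 1"
    using assms(6) by (simp_all add: layer_def split: if_splits)
  have "(q dvd m \<longleftrightarrow> q dvd n) \<and> (\<not> q dvd m \<longrightarrow> (r dvd m \<longleftrightarrow> r dvd n))"
    using eq ne unfolding layer_def by (simp only: if_False split: if_split_asm) simp_all
  then consider "q dvd m \<and> q dvd n" | "r dvd m \<and> r dvd n" |
    "\<not> q dvd m \<and> \<not> q dvd n \<and> \<not> r dvd m \<and> \<not> r dvd n"
    by blast
  then obtain l where "prime l" "l dvd m" "l dvd n"
  proof cases
    case 1
    then show ?thesis
      using that \<open>prime q\<close> by simp
  next
    case 2
    then show ?thesis
      using that \<open>prime r\<close> by simp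
  next
    case 3
    obtain k where k: "prime k" "k dvd m"
      using prime_factor_nat[OF ne(1)] by (elim exE conjE)
    obtain l where l: "prime l" "l dvd n"
      using prime_factor_nat[OF ne(2)] by (elim exE conjE)
    have "k = p" "l = p"
      using 3 k l supp(1)[OF k] supp(2)[OF l] by auto
    then show ?thesis
      using that k l by simp
  qed
  then show False
    using coprime_common_divisor[OF \<open>coprime m n\<close>, of l] not_prime_unit[of l] by metis
qed

text \<open>Strictly increasing layers above the identity are 1, 2, 3, so \<open>m\<close> is divisible by \<open>q\<close>, \<open>n\<close> is a
  power of \<open>p\<close>, and \<open>k\<close> is divisible by \<open>r\<close>. Being coprime to \<open>n\<close>, \<open>m\<close> is not divisible by \<open>p\<close>. A
  common prime divisor of \<open>m\<close> and \<open>k\<close> would thus be \<open>q\<close> or \<open>r\<close>, and then \<open>q\<close> and \<open>r\<close> would both divide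
  \<open>k\<close> or both divide \<open>m\<close>.\<close>

lemma coprime_layer_trans:
  assumes "prime p"
    and supp: "\<And>l. prime l \<Longrightarrow> l dvd m \<Longrightarrow> l \<in> {p, q, r}"
      "\<And>l. prime l \<Longrightarrow> l dvd n \<Longrightarrow> l \<in> {p, q, r}"
    and no_qr: "\<not> (q dvd m \<and> r dvd m)" "\<not> (q dvd k \<and> r dvd k)"
    and "coprime m n"
    and less: "layer q r m < layer q r n" "layer q r n < layer q r k"
  shows "coprime m k"
proof (cases "m = 1")
  case False
  then have "q dvd m" "n \<noteq> 1" "\<not> q dvd n" "\<not> r dvd n" "r dvd k"
    using less unfolding layer_def by (simp_all split: if_split_asm)
  obtain l where l: "prime l" "l dvd n"
    using prime_factor_nat[OF \<open>n \<noteq> 1\<close>] by (elim exE conjE)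
  then have "p dvd n"
    using supp(2)[OF l] \<open>\<not> q dvd n\<close> \<open>\<not> r dvd n\<close> by auto
  then have "\<not> p dvd m"
    using coprime_common_divisor[OF \<open>coprime m n\<close>, of p] not_prime_unit[of p] \<open>prime p\<close> by argo
  show ?thesis
  proof (rule ccontr)
    assume "\<not> coprime m k"
    then obtain l where l: "prime l" "l dvd gcd m k"
      using prime_factor_nat[of "gcd m k"] by (auto simp: coprime_iff_gcd_eq_1)
    then show False
      using supp(1)[of l] no_qr \<open>q dvd m\<close> \<open>r dvd k\<close> \<open>\<not> p dvd m\<close> by auto
  qed
qed simp

lemma (in group) divisor_graph_if_missing_product:
  assumes "finite (carrier G)" and "prime p" "prime q" "prime r" and "q \<noteq> r"
    and "prime_divisors G = {p, q, r}" and "q * r \<notin> element_orders G"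
  shows "divisor_graph (coprime_graph G)"
proof -
  have supp: "l \<in> {p, q, r}" if "x \<in> carrier G" "prime l" "l dvd ord x" for x l
    using that assms(1,6) ord_dvd_group_order[of x] dvd_trans
    unfolding prime_divisors_def by blast
  have no_qr: "\<not> (q dvd ord x \<and> r dvd ord x)" if x: "x \<in> carrier G" for x
  proof
    assume "q dvd ord x \<and> r dvd ord x"
    then have "q * r dvd ord x"
      using assms(3-5) by (simp add: divides_mult primes_coprime)
    then obtain y where "y \<in> carrier G" "ord y = q * r"
      by (rule exists_elem_ord_dvd[OF assms(1) x])
    moreover have "q * r \<noteq> 1"
      using assms(3) by auto
    ultimately show False
      using assms(7) ord_in_element_orders[of y] by simp
  qed
  define less where "less x y \<longleftrightarrow>
    coprime (ord x) (ord y) \<and> layer q r (ord x) < layer q r (ord y)" for x y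
  show ?thesis
  proof (rule divisor_graph_if_transitively_oriented[OF coprime_graph_simple, where less = less])
    show "finite (pverts (coprime_graph G))"
      using assms(1) by (simp add: coprime_graph_def)
    show "\<not> less x x" for x
      by (simp add: less_def)
    show "less x z" if "x \<in> pverts (coprime_graph G)" "y \<in> pverts (coprime_graph G)"
      "z \<in> pverts (coprime_graph G)" "less x y" "less y z" for x y z
    proof -
      have xyz: "x \<in> carrier G" "y \<in> carrier G" "z \<in> carrier G"
        using that by (simp_all add: coprime_graph_def)
      have less: "coprime (ord x) (ord y)" "layer q r (ord x) < layer q r (ord y)"
        "layer q r (ord y) < layer q r (ord z)"
        using that(4,5) by (simp_all add: less_def)
      have "coprime (ord x) (ord z)"
        by (rule coprime_layer_trans[OF \<open>prime p\<close> _ _ no_qr[OF xyz(1)] no_qr[OF xyz(3)] less])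
          (erule (1) supp[OF xyz(1)], erule (1) supp[OF xyz(2)])
      then show ?thesis
        using less(2,3) by (simp add: less_def)
    qed
    show "(x, y) \<in> parcs (coprime_graph G) \<longleftrightarrow> less x y \<or> less y x"
      if "x \<in> pverts (coprime_graph G)" "y \<in> pverts (coprime_graph G)" "x \<noteq> y" for x y
    proof -
      have xy: "x \<in> carrier G" "y \<in> carrier G"
        using that(1,2) by (simp_all add: coprime_graph_def)
      have nontrivial: "\<not> (ord x = 1 \<and> ord y = 1)"
        using that(3) ord_eq_1[OF xy(1)] ord_eq_1[OF xy(2)] by metis
      have "layer q r (ord x) \<noteq> layer q r (ord y)" if coprime: "coprime (ord x) (ord y)"
        by (rule coprime_layer_neq[OF \<open>prime q\<close> \<open>prime r\<close> _ _ coprime nontrivial])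
          (erule (1) supp[OF xy(1)], erule (1) supp[OF xy(2)])
      then show ?thesis
        using xy that(3) unfolding coprime_graph_arc_iff less_def
        by (metis coprime_commute linorder_neqE_nat)
    qed
  qed
qed

section \<open>All products of two primes present\<close>

lemma (in group) not_divisor_graph_if_all_products:
  assumes "finite (carrier G)" and "prime p" "prime q" "prime r"
    and "p \<noteq> q" "p \<noteq> r" "q \<noteq> r" and "{p * q, p * r, q * r} \<subseteq> element_orders G"
  shows "\<not> divisor_graph (coprime_graph G)"
proof
  assume div: "divisor_graph (coprime_graph G)"
  obtain p' q' r' where
    pendant: "p' \<in> carrier G" "ord p' = q * r" "q' \<in> carrier G" "ord q' = p * r"
      "r' \<in> carrier G" "ord r' = p * q"
    using assms(8) by (auto simp: element_orders_def)
  obtain a where a: "a \<in> carrier G" "ord a = p"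
    using exists_elem_ord_dvd[OF assms(1) pendant(3), of p] pendant(4) by auto
  obtain b where b: "b \<in> carrier G" "ord b = q"
    using exists_elem_ord_dvd[OF assms(1) pendant(1), of q] pendant(2) by auto
  obtain c where c: "c \<in> carrier G" "ord c = r"
    using exists_elem_ord_dvd[OF assms(1) pendant(1), of r] pendant(2) by auto
  have cop: "coprime p q" "coprime p r" "coprime q r" "coprime q p" "coprime r p" "coprime r q"
    using assms(2-7) by (simp_all add: primes_coprime)
  have unit: "\<not> is_unit p" "\<not> is_unit q" "\<not> is_unit r"
    using assms(2-4) not_prime_unit by metis+
  have arc: "(x, y) \<in> parcs (coprime_graph G) \<longleftrightarrow> coprime (ord x) (ord y)"
    if "x \<in> carrier G" "y \<in> carrier G" "\<not> is_unit (ord x)" for x y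
    \<comment> \<open>Adjacency presupposes distinctness, and a nontrivial order is not coprime to itself.\<close>
    using that by (auto simp: coprime_graph_arc_iff)
  show False
    by (rule no_net_in_divisor_graph[OF div, of a b c p' q' r'])
      (use a b c pendant cop unit in \<open>simp_all add: arc\<close>)
qed

section \<open>The characterization\<close>

theorem theorem5p5:
  fixes G :: "('a, 'b) monoid_scheme" and p q r :: nat
  assumes "group G" and "finite (carrier G)"
    and "prime p" and "prime q" and "prime r"
    and "p \<noteq> q" and "p \<noteq> r" and "q \<noteq> r"
    and "prime_divisors G = {p, q, r}"
  shows "divisor_graph (coprime_graph G) \<longleftrightarrow> \<not> {p * q, p * r, q * r} \<subseteq> element_orders G"
proof
  interpret group G by fact
  show "\<not> {p * q, p * r, q * r} \<subseteq> element_orders G" if "divisor_graph (coprime_graph G)"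
    using that not_divisor_graph_if_all_products assms by blast
  assume "\<not> {p * q, p * r, q * r} \<subseteq> element_orders G"
  then consider "p * q \<notin> element_orders G" | "p * r \<notin> element_orders G" | "q * r \<notin> element_orders G"
    by blast
  then show "divisor_graph (coprime_graph G)"
  proof cases
    case 1
    then show ?thesis
      using divisor_graph_if_missing_product[of r p q] assms by (simp add: insert_commute)
  next
    case 2
    then show ?thesis
      using divisor_graph_if_missing_product[of q p r] assms by (simp add: insert_commute)
  next
    case 3
    then show ?thesis
      using divisor_graph_if_missing_product[of p q r] assms by simp
  qed
qed

end
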